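(* Let $K$ be an infinite field with $\mathrm{char}(K)=2$, let $Q\in\mathcal{Q}(n,d,m)$, and let $h$ be a closed path in $Q$ with $h\not\equiv0$. Then $\deg(h)\leq 2m(d-n)+m$.
   Context: A quiver $Q$ is a finite oriented graph; for an arrow $a$, $a''$ is its tail and $a'$ its head. A path $a=a_1\cdots a_s$ ($a_i$ arrows) satisfies $a_i'=a_{i+1}''$; it is closed (in the vertex $a_1''$) if $a_1''=a_s'$; $\deg(a)=s$, $V(a)=\{a_1'',a_1',\dots,a_s'\}$. A closed path is primitive if each vertex of $V(a)$ is the head of exactly one $a_i$. $m(Q)$ is the maximal degree of a primitive closed path; $Q$ is strongly connected if some closed path contains all vertices; $\mathcal{Q}(n,d,m)$ is the set of strongly connected quivers with $n$ vertices, $d$ arrows and $m(Q)=m$. Closed paths are incident if they are closed in the same vertex. The equivalence $\equiv$ (for $\mathrm{char}(K)=2$) is the equivalence relation on the set of closed paths of $Q$ together with the symbol $0$ generated by: (1) $ab\equiv ba$ for paths $a,b$ such that $ab$ is a closed path; (2) $a_{\sigma(1)}\cdots a_{\sigma(t)}\equiv a_1\cdots a_t$ for incident closed paths $a_1,\dots,a_t$, $t\geq2$, $\sigma\in S_t$; (3) $a_1^2a_2\equiv0$ for incident closed paths $a_1,a_2$; (4) $a_1^2\equiv0$ for every closed path $a_1$. *)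

theory Defs
  imports Main "HOL-Library.Multiset"
begin

definition quiver :: "'v set \<Rightarrow> 'a set \<Rightarrow> ('a \<Rightarrow> 'v) \<Rightarrow> ('a \<Rightarrow> 'v) \<Rightarrow> bool" where
  "quiver Vs As src tgt \<longleftrightarrow> finite Vs \<and> finite As \<and> (\<forall>a\<in>As. src a \<in> Vs \<and> tgt a \<in> Vs)"

definition is_path :: "'a set \<Rightarrow> ('a \<Rightarrow> 'v) \<Rightarrow> ('a \<Rightarrow> 'v) \<Rightarrow> 'a list \<Rightarrow> bool" where
  "is_path As src tgt p \<longleftrightarrow> p \<noteq> [] \<and> set p \<subseteq> As \<and>
     (\<forall>i. Suc i < length p \<longrightarrow> tgt (p ! i) = src (p ! Suc i))"

definition closed_path :: "'a set \<Rightarrow> ('a \<Rightarrow> 'v) \<Rightarrow> ('a \<Rightarrow> 'v) \<Rightarrow> 'a list \<Rightarrow> bool" where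
  "closed_path As src tgt p \<longleftrightarrow> is_path As src tgt p \<and> src (hd p) = tgt (last p)"

definition path_vertices :: "('a \<Rightarrow> 'v) \<Rightarrow> ('a \<Rightarrow> 'v) \<Rightarrow> 'a list \<Rightarrow> 'v set" where
  "path_vertices src tgt p = insert (src (hd p)) (tgt ` set p)"

definition primitive :: "'a set \<Rightarrow> ('a \<Rightarrow> 'v) \<Rightarrow> ('a \<Rightarrow> 'v) \<Rightarrow> 'a list \<Rightarrow> bool" where
  "primitive As src tgt p \<longleftrightarrow> closed_path As src tgt p \<and>
     (\<forall>v\<in>path_vertices src tgt p. card {i. i < length p \<and> tgt (p ! i) = v} = 1)"

definition mQ :: "'a set \<Rightarrow> ('a \<Rightarrow> 'v) \<Rightarrow> ('a \<Rightarrow> 'v) \<Rightarrow> nat" where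
  "mQ As src tgt = Max (length ` {p. primitive As src tgt p})"

definition strongly_connected :: "'v set \<Rightarrow> 'a set \<Rightarrow> ('a \<Rightarrow> 'v) \<Rightarrow> ('a \<Rightarrow> 'v) \<Rightarrow> bool" where
  "strongly_connected Vs As src tgt \<longleftrightarrow>
     (\<exists>p. closed_path As src tgt p \<and> Vs \<subseteq> path_vertices src tgt p)"

definition in_Qndm :: "'v set \<Rightarrow> 'a set \<Rightarrow> ('a \<Rightarrow> 'v) \<Rightarrow> ('a \<Rightarrow> 'v) \<Rightarrow> nat \<Rightarrow> nat \<Rightarrow> nat \<Rightarrow> bool" where
  "in_Qndm Vs As src tgt n d m \<longleftrightarrow> quiver Vs As src tgt \<and> strongly_connected Vs As src tgt \<and>
     card Vs = n \<and> card As = d \<and> mQ As src tgt = m"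

definition incident :: "('a \<Rightarrow> 'v) \<Rightarrow> 'a list \<Rightarrow> 'a list \<Rightarrow> bool" where
  "incident src p q \<longleftrightarrow> src (hd p) = src (hd q)"

text \<open>The equivalence relation on closed paths together with the symbol 0,
  represented as \<open>'a list option\<close> with \<open>None\<close> standing for 0,
  generated by relations (1)-(4).\<close>
inductive path_equiv :: "'a set \<Rightarrow> ('a \<Rightarrow> 'v) \<Rightarrow> ('a \<Rightarrow> 'v) \<Rightarrow> 'a list option \<Rightarrow> 'a list option \<Rightarrow> bool"
  for As src tgt where
  refl_zero: "path_equiv As src tgt None None"
| refl_path: "closed_path As src tgt p \<Longrightarrow> path_equiv As src tgt (Some p) (Some p)"
| sym: "path_equiv As src tgt x y \<Longrightarrow> path_equiv As src tgt y x"
| trans: "path_equiv As src tgt x y \<Longrightarrow> path_equiv As src tgt y z \<Longrightarrow> path_equiv As src tgt x z"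
| rot: "is_path As src tgt a \<Longrightarrow> is_path As src tgt b \<Longrightarrow> closed_path As src tgt (a @ b) \<Longrightarrow>
        path_equiv As src tgt (Some (a @ b)) (Some (b @ a))"
| perm: "length as \<ge> 2 \<Longrightarrow> (\<forall>c\<in>set as. closed_path As src tgt c) \<Longrightarrow>
         (\<forall>c\<in>set as. \<forall>c'\<in>set as. incident src c c') \<Longrightarrow> mset bs = mset as \<Longrightarrow>
         path_equiv As src tgt (Some (concat bs)) (Some (concat as))"
| sq_mul: "closed_path As src tgt a1 \<Longrightarrow> closed_path As src tgt a2 \<Longrightarrow> incident src a1 a2 \<Longrightarrow>
         path_equiv As src tgt (Some (a1 @ a1 @ a2)) None"
| sq: "closed_path As src tgt a1 \<Longrightarrow> path_equiv As src tgt (Some (a1 @ a1)) None"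

end

theory Submission
  imports Defs
begin

text \<open>
  Let \<open>A\<close> and \<open>V\<close> be the sets of arrows and vertices of \<open>h\<close>. If all arrows of a primitive closed path
  occur at least three times in \<open>h\<close>, then permuting closed subpaths makes longer and longer prefixes
  of that path occur twice, until its square appears and \<open>h \<equiv> 0\<close>. Hence the arrows of multiplicity at
  least three are acyclic; extend them to a maximal acyclic set \<open>T \<subseteq> A\<close>. Splitting \<open>h\<close> into primitive
  closed paths, each of which has an arrow outside \<open>T\<close>, shows that \<open>deg h\<close> is at most \<open>m\<close> times the number
  of occurrences of arrows of \<open>A - T\<close>, and each of these arrows occurs at most twice. By maximality
  \<open>T\<close> connects \<open>V\<close>, so \<open>card (A - T) \<le> card A - card V + 1\<close>, which is one too many only if \<open>T\<close> is a tree
  and all arrows of \<open>A - T\<close> occur exactly twice. In that case contracting the leaf arrows of \<open>T\<close> one at a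
  time preserves the equivalence and ends with a loop occurring twice, so \<open>h \<equiv> 0\<close>.
\<close>

subsection \<open>Walks and elementary equivalences\<close>

text \<open>Unlike \<open>is_path\<close>, a walk may be empty and names both endpoints, so cutting
  and joining need no side conditions on emptiness.\<close>

fun walk :: "'a set \<Rightarrow> ('a \<Rightarrow> 'v) \<Rightarrow> ('a \<Rightarrow> 'v) \<Rightarrow> 'v \<Rightarrow> 'a list \<Rightarrow> 'v \<Rightarrow> bool" where
  "walk A src tgt u [] v \<longleftrightarrow> u = v"
| "walk A src tgt u (a # p) v \<longleftrightarrow> a \<in> A \<and> src a = u \<and> walk A src tgt (tgt a) p v"

lemma walk_append:
  "walk A src tgt u (p @ q) v \<longleftrightarrow> (\<exists>w. walk A src tgt u p w \<and> walk A src tgt w q v)"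
  by (induction p arbitrary: u) auto

lemma walk_appendI [intro]:
  "walk A src tgt u p w \<Longrightarrow> walk A src tgt w q v \<Longrightarrow> walk A src tgt u (p @ q) v"
  by (auto simp: walk_append)

lemma walk_append_Cons [simp]:
  "walk A src tgt u (p @ a # q) v \<longleftrightarrow>
    walk A src tgt u p (src a) \<and> a \<in> A \<and> walk A src tgt (tgt a) q v"
  by (auto simp: walk_append)

lemma walk_append_append_Cons [simp]:
  "walk A src tgt u (r @ p @ a # q) v \<longleftrightarrow>
    walk A src tgt u (r @ p) (src a) \<and> a \<in> A \<and> walk A src tgt (tgt a) q v"
  using walk_append_Cons[of A src tgt u "r @ p"] by simp

lemma walk_mono: "walk A src tgt u p v \<Longrightarrow> set p \<subseteq> B \<Longrightarrow> walk B src tgt u p v"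
  by (induction p arbitrary: u) auto

lemma walk_set: "walk A src tgt u p v \<Longrightarrow> set p \<subseteq> A"
  by (induction p arbitrary: u) auto

lemma walk_hd: "walk A src tgt u p v \<Longrightarrow> p \<noteq> [] \<Longrightarrow> src (hd p) = u"
  by (cases p) auto

lemma walk_last: "walk A src tgt u p v \<Longrightarrow> p \<noteq> [] \<Longrightarrow> tgt (last p) = v"
  by (induction p arbitrary: u) auto

lemma is_path_iff_walk:
  "is_path A src tgt p \<longleftrightarrow> p \<noteq> [] \<and> walk A src tgt (src (hd p)) p (tgt (last p))"
proof (induction p)
  case Nil
  then show ?case by (simp add: is_path_def)
next
  case (Cons a p)
  show ?case
  proof (cases p)
    case Nil
    then show ?thesis by (auto simp: is_path_def)
  next
    case (Cons b q)
    have "is_path A src tgt (a # p) \<longleftrightarrow> a \<in> A \<and> tgt a = src (hd p) \<and> is_path A src tgt p"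
    proof -
      have "(\<forall>i. P i) \<longleftrightarrow> P 0 \<and> (\<forall>i. P (Suc i))" for P :: "nat \<Rightarrow> bool"
        by (metis nat.exhaust)
      from this[of "\<lambda>i. Suc i < length (a # p) \<longrightarrow> tgt ((a # p) ! i) = src ((a # p) ! Suc i)"]
      show ?thesis
        unfolding is_path_def Cons by auto
    qed
    then show ?thesis
      using Cons.IH Cons by auto
  qed
qed

lemma closed_path_iff_walk:
  "closed_path A src tgt p \<longleftrightarrow> p \<noteq> [] \<and> (\<exists>u. walk A src tgt u p u)"
  unfolding closed_path_def is_path_iff_walk by (metis walk_hd walk_last)

lemma closed_pathI: "walk A src tgt u p u \<Longrightarrow> p \<noteq> [] \<Longrightarrow> closed_path A src tgt p"
  by (auto simp: closed_path_iff_walk)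

lemma is_pathI: "walk A src tgt u p v \<Longrightarrow> p \<noteq> [] \<Longrightarrow> is_path A src tgt p"
  by (metis is_path_iff_walk walk_hd walk_last)

text \<open>Along a walk from \<open>u\<close> to \<open>v\<close> the sources together with
  \<open>v\<close> are the targets together with \<open>u\<close>. For \<open>u = v\<close> this
  vertex already lies on both sides.\<close>

lemma walk_closed_src_eq_tgt:
  assumes "walk A src tgt u p u"
  shows "src ` set p = tgt ` set p"
proof -
  have "insert v (src ` set p) = insert u (tgt ` set p)" if "walk A src tgt u p v" for u v
    using that by (induction p arbitrary: u) auto
  moreover have "u \<in> src ` set p" "u \<in> tgt ` set p" if "p \<noteq> []"
    using walk_hd[OF assms that] walk_last[OF assms that] that by (metis image_eqI hd_in_set last_in_set)+
  ultimately show ?thesis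
    using assms by (cases "p = []") (simp, metis insert_absorb)
qed

lemma path_equiv_rot:
  assumes "walk A src tgt u (p @ q) u" and "p @ q \<noteq> []"
  shows "path_equiv A src tgt (Some (p @ q)) (Some (q @ p))"
proof (cases "p = [] \<or> q = []")
  case True
  then show ?thesis
    using assms closed_pathI path_equiv.refl_path by fastforce
next
  case False
  then show ?thesis
    using assms(1) closed_pathI[OF assms] unfolding walk_append
    by (auto intro: path_equiv.rot is_pathI)
qed

lemma walk_rot: "walk A src tgt u (p @ q) u \<Longrightarrow> \<exists>w. walk A src tgt w (q @ p) w"
  by (auto simp: walk_append)

lemma walk_concat: "(\<And>c. c \<in> set cs \<Longrightarrow> walk A src tgt u c u) \<Longrightarrow> walk A src tgt u (concat cs) u"
  by (induction cs) auto

lemma concat_filter_nonempty: "concat (filter (\<lambda>c. c \<noteq> []) cs) = concat cs"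
  by (induction cs) auto

text \<open>Relation (2) for possibly empty blocks, the form in which paths are rearranged later.
  Empty blocks are dropped; if a single block remains, both concatenations coincide.\<close>

lemma path_equiv_permute:
  assumes closed: "\<And>c. c \<in> set cs \<Longrightarrow> walk A src tgt u c u"
    and "concat cs \<noteq> []" and "mset ds = mset cs"
  shows "path_equiv A src tgt (Some (concat ds)) (Some (concat cs))"
proof -
  let ?N = "filter (\<lambda>c. c \<noteq> [])"
  have ms: "mset (?N ds) = mset (?N cs)"
    using assms(3) by simp
  have "path_equiv A src tgt (Some (concat (?N ds))) (Some (concat (?N cs)))"
  proof (cases "length (?N cs) \<ge> 2")
    case True
    show ?thesis
      using closed
      by (intro path_equiv.perm True ms)
        (auto intro: closed_pathI simp: incident_def dest: walk_hd)
  next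
    case False
    have "length (?N cs) \<noteq> 0"
      using assms(2) concat_filter_nonempty[of cs] by (metis concat.simps(1) length_0_conv)
    then obtain c where c: "?N cs = [c]"
      using False by (metis One_nat_def Suc_1 length_0_conv length_Suc_conv less_2_cases not_less)
    then have "?N ds = ?N cs"
      using ms by (simp del: mset_filter)
    then show ?thesis
      using walk_concat[of cs A src tgt u] closed assms(2)
      by (auto simp: concat_filter_nonempty intro!: path_equiv.refl_path closed_pathI)
  qed
  then show ?thesis
    by (simp add: concat_filter_nonempty)
qed

text \<open>Permuting the closed blocks brings the two copies of \<open>p\<close> together. Then (3)
  applies with second factor \<open>x @ y\<close>, or (4) if that factor is empty.\<close>

lemma path_equiv_repeated_closed:
  assumes "walk A src tgt u p u" "walk A src tgt u x u" "walk A src tgt u y u" and "p \<noteq> []"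
  shows "path_equiv A src tgt (Some (p @ x @ p @ y)) None"
proof -
  have "path_equiv A src tgt (Some (concat [p, x, p, y])) (Some (concat [p, p, x, y]))"
    using assms by (intro path_equiv_permute[where u = u]) auto
  moreover have "path_equiv A src tgt (Some (p @ p @ x @ y)) None"
  proof (cases "x @ y = []")
    case True
    then show ?thesis
      using path_equiv.sq[of A src tgt p] assms by (simp add: closed_pathI)
  next
    case False
    have "walk A src tgt u (x @ y) u"
      using assms by auto
    then show ?thesis
      using False assms
      by (intro path_equiv.sq_mul) (simp_all add: closed_pathI incident_def walk_hd del: append_is_Nil_conv)
  qed
  ultimately show ?thesis
    by (auto intro: path_equiv.trans)
qed

lemma split_count:
  assumes "count (mset x) e \<ge> Suc k"
  obtains a b where "x = a @ e # b" "count (mset b) e \<ge> k"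
proof -
  have "e \<in> set x"
    using assms by (metis Suc_le_D count_inI nat.distinct(1) set_mset_mset)
  then obtain a b where "x = a @ e # b" "e \<notin> set a"
    by (meson split_list_first)
  then have "count (mset a) e = 0"
    by (simp add: count_eq_zero_iff)
  moreover have "count (mset x) e = count (mset a) e + 1 + count (mset b) e"
    using \<open>x = a @ e # b\<close> by simp
  ultimately show thesis
    using that[of a b] assms \<open>x = a @ e # b\<close> by linarith
qed

subsection \<open>Cycles of frequent arrows\<close>

text \<open>
  At the vertex \<open>src e\<close> the path splits into closed blocks, two of which end with \<open>p\<close> and three of which
  start with \<open>e\<close>; the order \<open>ds\<close> puts a block starting with \<open>e\<close> behind each of the two ending with \<open>p\<close>.
\<close>

lemma extend_repeated_prefix_aux:
  assumes w: "walk A src tgt u (p @ x @ p @ y) u" and p: "p \<noteq> []"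
    and tgt_p: "tgt (last p) = src e" and e: "e \<notin> set p"
    and cnt: "count (mset x) e \<ge> 3 \<or> count (mset x) e \<ge> 2 \<and> count (mset y) e \<ge> 1"
  shows "\<exists>x' y'. path_equiv A src tgt (Some (p @ x @ p @ y)) (Some ((p @ [e]) @ x' @ (p @ [e]) @ y'))
    \<and> (\<exists>w. walk A src tgt w ((p @ [e]) @ x' @ (p @ [e]) @ y') w)
    \<and> mset ((p @ [e]) @ x' @ (p @ [e]) @ y') = mset (p @ x @ p @ y)"
proof -
  let ?v = "src e"
  have wp: "walk A src tgt u p ?v" and wx: "walk A src tgt ?v x u" and wy: "walk A src tgt ?v y u"
    using w walk_hd[OF _ p] walk_last[OF _ p] tgt_p unfolding walk_append by metis+
  have rot1: "path_equiv A src tgt (Some (p @ x @ p @ y)) (Some (x @ p @ y @ p))"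
    using path_equiv_rot[of A src tgt u p "x @ p @ y"] w p by simp
  from cnt show ?thesis
  proof
    assume "count (mset x) e \<ge> 3"
    then obtain \<alpha> x1 where x1: "x = \<alpha> @ e # x1" "count (mset x1) e \<ge> 2"
      using split_count[of 2 x e] by (auto simp: numeral_3_eq_3 numeral_2_eq_2)
    then obtain \<beta> x2 where x2: "x1 = \<beta> @ e # x2" "count (mset x2) e \<ge> 1"
      using split_count[of 1 x1 e] by (auto simp: numeral_2_eq_2)
    then obtain \<beta>' \<gamma> where x3: "x2 = \<beta>' @ e # \<gamma>"
      using split_count[of 0 x2 e] by auto
    have x: "x = \<alpha> @ e # \<beta> @ e # \<beta>' @ e # \<gamma>"
      using x1 x2 x3 by simp
    let ?cs = "[\<alpha>, e # \<beta>, e # \<beta>', e # \<gamma> @ p, y @ p]"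
    let ?ds = "[y @ p, e # \<beta>, e # \<gamma> @ p, e # \<beta>', \<alpha>]"
    let ?r = "(p @ [e]) @ (\<beta> @ e # \<gamma>) @ (p @ [e]) @ (\<beta>' @ \<alpha> @ y)"
    have "path_equiv A src tgt (Some (concat ?ds)) (Some (concat ?cs))"
      using wp wx wy unfolding x by (intro path_equiv_permute[where u = ?v]) auto
    then have "path_equiv A src tgt (Some (x @ p @ y @ p)) (Some (concat ?ds))"
      by (auto simp: x intro: path_equiv.sym)
    moreover have wr: "walk A src tgt u ?r u"
      using wp wx wy unfolding x by auto
    then have "path_equiv A src tgt (Some (concat ?ds)) (Some ?r)"
      using wp wx wy path_equiv_rot[of A src tgt ?v y "(p @ [e]) @ (\<beta> @ e # \<gamma>) @ (p @ [e]) @ (\<beta>' @ \<alpha>)"] p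
      unfolding x by auto
    moreover have "mset ?r = mset (p @ x @ p @ y)"
      by (simp add: x)
    ultimately show ?thesis
      using path_equiv.trans[OF rot1] path_equiv.trans wr by blast
  next
    assume c: "count (mset x) e \<ge> 2 \<and> count (mset y) e \<ge> 1"
    then have "count (mset x) e \<ge> 2"
      by simp
    then obtain \<alpha> x1 where x1: "x = \<alpha> @ e # x1" "count (mset x1) e \<ge> 1"
      using split_count[of 1 x e] by (auto simp: numeral_2_eq_2)
    from x1(2) obtain \<beta> \<gamma> where x2: "x1 = \<beta> @ e # \<gamma>"
      using split_count[of 0 x1 e] by auto
    from c obtain \<delta> \<epsilon> where y: "y = \<delta> @ e # \<epsilon>"
      using split_count[of 0 y e] by auto
    have x: "x = \<alpha> @ e # \<beta> @ e # \<gamma>"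
      using x1 x2 by simp
    let ?cs = "[\<alpha>, e # \<beta>, e # \<gamma> @ p, \<delta>, e # \<epsilon> @ p]"
    let ?ds = "[e # \<gamma> @ p, e # \<epsilon> @ p, e # \<beta>, \<alpha>, \<delta>]"
    let ?r = "(p @ [e]) @ \<epsilon> @ (p @ [e]) @ (\<beta> @ \<alpha> @ \<delta> @ e # \<gamma>)"
    have "path_equiv A src tgt (Some (concat ?ds)) (Some (concat ?cs))"
      using wp wx wy unfolding x y by (intro path_equiv_permute[where u = ?v]) auto
    then have "path_equiv A src tgt (Some (x @ p @ y @ p)) (Some (concat ?ds))"
      by (auto simp: x y intro: path_equiv.sym)
    moreover have wr: "walk A src tgt u ?r u"
      using wp wx wy walk_append_append_Cons[of A src tgt "tgt e" "\<beta> @ \<alpha>" \<delta> e \<gamma> u]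
      unfolding x y by auto
    then have "path_equiv A src tgt (Some (concat ?ds)) (Some ?r)"
      using wp wx wy path_equiv_rot[of A src tgt ?v "e # \<gamma>" "(p @ [e]) @ \<epsilon> @ (p @ [e]) @ (\<beta> @ \<alpha> @ \<delta>)"] p
      unfolding x y by auto
    moreover have "mset ?r = mset (p @ x @ p @ y)"
      by (simp add: x y)
    ultimately show ?thesis
      using path_equiv.trans[OF rot1] path_equiv.trans wr by blast
  qed
qed

text \<open>As \<open>e\<close> is not in \<open>p\<close>, its three occurrences lie in
  \<open>x\<close> and \<open>y\<close>, distributed 3+0 or 2+1 up to exchanging them, and a
  rotation exchanges \<open>x\<close> and \<open>y\<close>.\<close>

lemma extend_repeated_prefix:
  assumes w: "walk A src tgt u (p @ x @ p @ y) u" and p: "p \<noteq> []"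
    and tgt_p: "tgt (last p) = src e" and e: "e \<notin> set p"
    and cnt: "count (mset (p @ x @ p @ y)) e \<ge> 3"
  shows "\<exists>x' y'. path_equiv A src tgt (Some (p @ x @ p @ y)) (Some ((p @ [e]) @ x' @ (p @ [e]) @ y'))
    \<and> (\<exists>w. walk A src tgt w ((p @ [e]) @ x' @ (p @ [e]) @ y') w)
    \<and> mset ((p @ [e]) @ x' @ (p @ [e]) @ y') = mset (p @ x @ p @ y)"
proof -
  have "count (mset x) e + count (mset y) e \<ge> 3"
  proof -
    have "count (mset p) e = 0"
      using e by (simp add: count_eq_zero_iff)
    moreover have "count (mset (p @ x @ p @ y)) e =
      2 * count (mset p) e + count (mset x) e + count (mset y) e"
      by simp
    ultimately show ?thesis
      using cnt by linarith
  qed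
  then consider
    "count (mset x) e \<ge> 3 \<or> count (mset x) e \<ge> 2 \<and> count (mset y) e \<ge> 1" |
    "count (mset y) e \<ge> 3 \<or> count (mset y) e \<ge> 2 \<and> count (mset x) e \<ge> 1"
    by linarith
  then show ?thesis
  proof cases
    case 1
    then show ?thesis
      using extend_repeated_prefix_aux[OF w p tgt_p e] by blast
  next
    case 2
    have w': "walk A src tgt u (p @ y @ p @ x) u"
      using w walk_hd[OF _ p] walk_last[OF _ p] unfolding walk_append by metis
    have "path_equiv A src tgt (Some (p @ x @ p @ y)) (Some (p @ y @ p @ x))"
      using path_equiv_rot[of A src tgt u "p @ x" "p @ y"] w p by simp
    note tr = path_equiv.trans[OF this]
    have ms: "mset (p @ x @ p @ y) = mset (p @ y @ p @ x)"
      by simp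
    show ?thesis
      unfolding ms using extend_repeated_prefix_aux[OF w' p tgt_p e 2] tr by blast
  qed
qed

text \<open>Induction on the prefix, starting from two occurrences of the first arrow. The multiset
  of arrows is kept, so the next arrow of \<open>c\<close> still occurs three times; by distinctness
  it is not in the prefix yet.\<close>

lemma repeated_prefix:
  assumes h: "walk A src tgt u h u" and c: "walk A src tgt v c v" "distinct c"
    and cnt: "\<And>a. a \<in> set c \<Longrightarrow> count (mset h) a \<ge> 3" and "j < length c"
  shows "\<exists>x y. path_equiv A src tgt (Some h) (Some (take (Suc j) c @ x @ take (Suc j) c @ y))
    \<and> (\<exists>w. walk A src tgt w (take (Suc j) c @ x @ take (Suc j) c @ y) w)
    \<and> mset (take (Suc j) c @ x @ take (Suc j) c @ y) = mset h"
  using assms(5)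
proof (induction j)
  case 0
  then obtain e c' where e: "c = e # c'"
    by (cases c) auto
  then have "count (mset h) e \<ge> Suc 1"
    using cnt[of e] by simp
  then obtain a b where ab: "h = a @ e # b" "count (mset b) e \<ge> Suc 0"
    using split_count[of 1 h e] by auto
  then obtain x d where "b = x @ e # d"
    using split_count[of 0 b e] by auto
  then have heq: "h = a @ (e # x @ e # d)"
    using ab by simp
  then have "path_equiv A src tgt (Some h) (Some (e # x @ e # d @ a))"
    using path_equiv_rot[of A src tgt u a "e # x @ e # d"] h by simp
  then show ?case
    using walk_rot[of A src tgt u a "e # x @ e # d"] h
    by (intro exI[of _ x] exI[of _ "d @ a"]) (simp add: e heq)
next
  case (Suc j)
  let ?p = "take (Suc j) c"
  let ?e = "c ! Suc j"
  obtain x y w where IH: "path_equiv A src tgt (Some h) (Some (?p @ x @ ?p @ y))"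
    "walk A src tgt w (?p @ x @ ?p @ y) w" "mset (?p @ x @ ?p @ y) = mset h"
    using Suc.IH Suc_lessD[OF Suc.prems] by blast
  have take: "take (Suc (Suc j)) c = ?p @ [?e]"
    using Suc.prems by (rule take_Suc_conv_app_nth)
  have split: "c = (?p @ [?e]) @ drop (Suc (Suc j)) c"
    unfolding take[symmetric] by simp
  have "walk A src tgt v ((?p @ [?e]) @ drop (Suc (Suc j)) c) v"
    using c(1) split by metis
  moreover have "?p \<noteq> []"
    using Suc.prems by auto
  ultimately have "tgt (last ?p) = src ?e"
    by (auto dest: walk_last)
  moreover have "?e \<notin> set ?p"
    using c(2) split by (metis distinct_append not_distinct_conv_prefix)
  moreover have "count (mset (?p @ x @ ?p @ y)) ?e \<ge> 3"
    unfolding IH(3) using cnt Suc.prems by simp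
  ultimately show ?case
    using extend_repeated_prefix[OF IH(2) \<open>?p \<noteq> []\<close>, of ?e] path_equiv.trans[OF IH(1)]
    unfolding take IH(3) by blast
qed

text \<open>Once all of \<open>c\<close> occurs twice, the pieces between its copies are closed at
  the same vertex because \<open>c\<close> is closed.\<close>

lemma path_equiv_zero_if_frequent_cycle:
  assumes h: "walk A src tgt u h u" and c: "walk A src tgt v c v" "distinct c" "c \<noteq> []"
    and cnt: "\<And>a. a \<in> set c \<Longrightarrow> count (mset h) a \<ge> 3"
  shows "path_equiv A src tgt (Some h) None"
proof -
  have "length c - 1 < length c"
    using c(3) by simp
  from repeated_prefix[OF h c(1,2) cnt this] obtain x y w where
    xy: "path_equiv A src tgt (Some h) (Some (c @ x @ c @ y))" "walk A src tgt w (c @ x @ c @ y) w"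
    using c(3) by (simp del: append_assoc) blast
  have "w = v"
    using walk_hd[OF c(1) c(3)] walk_hd[OF xy(2)] c(3) by simp
  then have "walk A src tgt v x v" "walk A src tgt v y v"
    using xy(2) walk_hd[OF _ c(3)] walk_last[OF _ c(3)] c(1) unfolding walk_append by metis+
  then show ?thesis
    using path_equiv_repeated_closed[OF c(1)] path_equiv.trans[OF xy(1)] c(3) by blast
qed


subsection \<open>Substitution and contraction\<close>

lemma walk_substitute:
  assumes "\<And>a. a \<in> A' \<Longrightarrow> walk A src tgt (src' a) (\<phi> a) (tgt' a)"
    and "walk A' src' tgt' u p v"
  shows "walk A src tgt u (concat (map \<phi> p)) v"
  using assms(2) by (induction p arbitrary: u) (auto simp: walk_append dest!: assms(1))

text \<open>Replacing arrows by nonempty walks with matching ends sends closed paths to closed paths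
  and preserves incidence, so each generating relation becomes an instance of itself. This carries
  equivalences back from a contracted quiver.\<close>

lemma path_equiv_substitute:
  assumes \<phi>: "\<And>a. a \<in> A' \<Longrightarrow> walk A src tgt (src' a) (\<phi> a) (tgt' a)" "\<And>a. \<phi> a \<noteq> []"
    and "path_equiv A' src' tgt' x y"
  shows "path_equiv A src tgt (map_option (\<lambda>p. concat (map \<phi> p)) x)
    (map_option (\<lambda>p. concat (map \<phi> p)) y)"
proof -
  let ?\<Phi> = "\<lambda>p. concat (map \<phi> p)"
  have ne: "?\<Phi> p \<noteq> []" if "p \<noteq> []" for p
    using that \<phi>(2) by (cases p) auto
  have sub: "walk A src tgt u (?\<Phi> p) v" if "walk A' src' tgt' u p v" for u p v
    using walk_substitute[of A' A src tgt src' \<phi> tgt'] \<phi>(1) that by blast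
  have cl: "closed_path A src tgt (?\<Phi> p)" if "closed_path A' src' tgt' p" for p
    using that ne sub unfolding closed_path_iff_walk by blast
  have pa: "is_path A src tgt (?\<Phi> p)" if "is_path A' src' tgt' p" for p
    using that is_pathI[OF sub ne] unfolding is_path_iff_walk[of A'] by blast
  have src: "src (hd (?\<Phi> p)) = src' (hd p)" if "closed_path A' src' tgt' p" for p
    using that walk_hd[OF sub ne] walk_hd[of A' src' tgt' _ p] unfolding closed_path_iff_walk by metis
  from assms(3) show ?thesis
  proof (induction rule: path_equiv.induct)
    case (trans x y z)
    show ?case
      using trans.IH by (rule path_equiv.trans)
  next
    case (rot a b)
    have "closed_path A src tgt (?\<Phi> a @ ?\<Phi> b)"
      using cl[OF rot(3)] by simp
    then show ?case
      using path_equiv.rot[OF pa[OF rot(1)] pa[OF rot(2)]] by simp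
  next
    case (perm as bs)
    have "incident src (?\<Phi> c) (?\<Phi> c')" if "c \<in> set as" "c' \<in> set as" for c c'
      using perm(2,3) that src unfolding incident_def by metis
    then have "path_equiv A src tgt (Some (concat (map ?\<Phi> bs))) (Some (concat (map ?\<Phi> as)))"
      using perm(1,2,4) cl by (intro path_equiv.perm) (simp_all add: image_iff)
    moreover have "?\<Phi> (concat cs) = concat (map ?\<Phi> cs)" for cs
      by (induction cs) auto
    ultimately show ?case by simp
  next
    case (sq_mul a1 a2)
    then have "incident src (?\<Phi> a1) (?\<Phi> a2)"
      by (simp add: incident_def src)
    then show ?case
      using path_equiv.sq_mul[OF cl[OF sq_mul(1)] cl[OF sq_mul(2)]] by simp
  next
    case (sq a1)
    then show ?case
      using path_equiv.sq[OF cl[OF sq]] by simp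
  next
    case (sym x y)
    show ?case
      using sym.IH by (rule path_equiv.sym)
  qed (auto intro: path_equiv.refl_zero path_equiv.refl_path cl)
qed

lemma path_equiv_mono:
  assumes "path_equiv A src tgt x y" and "A \<subseteq> B"
  shows "path_equiv B src tgt x y"
proof -
  have "concat (map (\<lambda>a. [a]) p) = p" for p :: "'a list"
    by (induction p) auto
  moreover have "path_equiv B src tgt (map_option (\<lambda>p. concat (map (\<lambda>a. [a]) p)) x)
    (map_option (\<lambda>p. concat (map (\<lambda>a. [a]) p)) y)"
    using assms(2) by (intro path_equiv_substitute[OF _ _ assms(1)]) auto
  ultimately show ?thesis
    by (simp add: option.map_ident)
qed

lemma path_equiv_zero_if_repeated_loop:
  assumes h: "walk A src tgt u h u" and "src e = tgt e" and "count (mset h) e \<ge> 2"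
  shows "path_equiv A src tgt (Some h) None"
proof -
  obtain a b where ab: "h = a @ e # b" "count (mset b) e \<ge> 1"
    using split_count[of 1 h e] assms(3) by (auto simp: numeral_2_eq_2)
  then obtain x d where "b = x @ e # d"
    using split_count[of 0 b e] by auto
  then have heq: "h = a @ (e # x @ e # d)"
    using ab by simp
  then have "path_equiv A src tgt (Some h) (Some (e # x @ e # d @ a))"
    using path_equiv_rot[of A src tgt u a "e # x @ e # d"] h by simp
  moreover have "path_equiv A src tgt (Some ([e] @ x @ [e] @ d @ a)) None"
    using h assms(2) unfolding heq
    by (intro path_equiv_repeated_closed[where u = "src e"]) auto
  ultimately show ?thesis
    using path_equiv.trans[of A src tgt "Some h"] by simp
qed

section \<open>Contracting an arrow and reinserting it\<close>

definition arrow_rel :: "('a \<Rightarrow> 'v) \<Rightarrow> ('a \<Rightarrow> 'v) \<Rightarrow> 'a set \<Rightarrow> ('v \<times> 'v) set" where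
  "arrow_rel src tgt T = (\<lambda>a. (src a, tgt a)) ` T"

lemma walk_contract:
  assumes "walk A src tgt x p y" and "\<pi> (src t) = \<pi> (tgt t)"
  shows "walk (A - {t}) (\<pi> \<circ> src) (\<pi> \<circ> tgt) (\<pi> x) (filter (\<lambda>a. a \<noteq> t) p) (\<pi> y)"
  using assms by (induction p arbitrary: x) auto

lemma arrow_rel_contract:
  assumes "(x, y) \<in> (arrow_rel src tgt T)\<^sup>*" and "\<pi> (src t) = \<pi> (tgt t)"
  shows "(\<pi> x, \<pi> y) \<in> (arrow_rel (\<pi> \<circ> src) (\<pi> \<circ> tgt) (T - {t}))\<^sup>*"
  using assms(1)
proof (induction rule: rtrancl_induct)
  case base
  then show ?case by simp
next
  case (step y z)
  then obtain a where a: "a \<in> T" "y = src a" "z = tgt a"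
    by (auto simp: arrow_rel_def)
  show ?case
  proof (cases "a = t")
    case True
    then show ?thesis
      using step.IH a assms(2) by simp
  next
    case False
    then have "(\<pi> y, \<pi> z) \<in> arrow_rel (\<pi> \<circ> src) (\<pi> \<circ> tgt) (T - {t})"
      using a by (auto simp: arrow_rel_def)
    then show ?thesis
      using step.IH by (rule rtrancl_into_rtrancl[rotated])
  qed
qed

lemma rotate_to_arrow:
  assumes h: "walk A src tgt u h u" and "a \<in> set h"
  obtains g where "walk A src tgt (src a) g (src a)" "path_equiv A src tgt (Some h) (Some g)"
    "mset g = mset h"
proof -
  obtain p q where pq: "h = p @ a # q"
    using assms(2) by (meson split_list)
  then have "walk A src tgt (src a) ((a # q) @ p) (src a)"
    using h by auto
  then show thesis
    using that[of "(a # q) @ p"] path_equiv_rot[of A src tgt u p "a # q"] h pq by simp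
qed

text \<open>If \<open>t\<close> is the only arrow entering \<open>v\<close>, every visit to
  \<open>v\<close> after the start comes through \<open>t\<close>, so putting \<open>t\<close>
  before each arrow leaving \<open>v\<close> undoes its deletion. Starting at \<open>v\<close>
  produces one extra \<open>t\<close>; \<open>y \<noteq> v\<close> rules out a final
  \<open>t\<close>, which would be lost.\<close>

lemma expand_in_arrow:
  assumes "walk A src tgt x p y" and "src t \<noteq> v" and "tgt t = v"
    and "\<And>a. a \<in> A \<Longrightarrow> tgt a = v \<Longrightarrow> a = t" and "y \<noteq> v"
  shows "concat (map (\<lambda>f. if src f = v then [t, f] else [f]) (filter (\<lambda>a. a \<noteq> t) p))
    = (if x = v then t # p else p)"
  using assms(1)
proof (induction p arbitrary: x)
  case Nil
  then show ?case using assms(5) by simp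
next
  case (Cons a p)
  then have w: "walk A src tgt (tgt a) p y" "src a = x" and "tgt a = v \<longleftrightarrow> a = t"
    using assms(3,4) by auto
  then show ?case
    using Cons.IH[OF w(1)] assms(2) by auto
qed

text \<open>If \<open>t\<close> is the only arrow leaving \<open>v\<close>, it follows every arrow
  entering \<open>v\<close>, as the walk does not end there. Only a \<open>t\<close> at the very
  start has no predecessor and is lost.\<close>

lemma expand_out_arrow:
  assumes "walk A src tgt x p y" and "tgt t \<noteq> v" and "src t = v"
    and "\<And>a. a \<in> A \<Longrightarrow> src a = v \<Longrightarrow> a = t" and "y \<noteq> v"
  shows "concat (map (\<lambda>f. if tgt f = v then [f, t] else [f]) (filter (\<lambda>a. a \<noteq> t) p))
    = (if x = v then tl p else p)"
  using assms(1)
proof (induction p arbitrary: x)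
  case Nil
  then show ?case using assms(5) by simp
next
  case (Cons a p)
  show ?case
  proof (cases "a = t")
    case True
    then show ?thesis using Cons assms(2,3) by auto
  next
    case False
    have w: "walk A src tgt (tgt a) p y" and "x \<noteq> v"
      using Cons.prems assms(4) False by auto
    show ?thesis
    proof (cases "tgt a = v")
      case True
      then obtain b q where "p = b # q"
        using w assms(5) by (cases p) auto
      then have "p = t # tl p"
        using w True assms(4) by auto
      then show ?thesis
        using Cons.IH[OF w] True False \<open>x \<noteq> v\<close> by auto
    next
      case notv: False
      then show ?thesis
        using Cons.IH[OF w] False \<open>x \<noteq> v\<close> by auto
    qed
  qed
qed

text \<open>Handshake count: the degrees add up to \<open>2 * card T\<close>, which is less than
  \<open>2 * card V\<close>.\<close>

lemma exists_vertex_degree_le_one: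
  assumes "finite V" "finite T" "card T < card V" "src ` T \<subseteq> V" "tgt ` T \<subseteq> V"
  shows "\<exists>v\<in>V. card {t \<in> T. src t = v} + card {t \<in> T. tgt t = v} \<le> 1"
proof (rule ccontr)
  assume "\<not> ?thesis"
  then have "card {t \<in> T. src t = v} + card {t \<in> T. tgt t = v} \<ge> 2" if "v \<in> V" for v
    using that by force
  then have "(\<Sum>v\<in>V. 2) \<le> (\<Sum>v\<in>V. card {t \<in> T. src t = v} + card {t \<in> T. tgt t = v})"
    by (intro sum_mono)
  also have "\<dots> = card T + card T"
    using sum.group[OF assms(2,1,4), of "\<lambda>_. 1::nat"] sum.group[OF assms(2,1,5), of "\<lambda>_. 1::nat"]
    by (simp add: sum.distrib)
  finally show False
    using assms(3) by simp
qed

text \<open>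
  A vertex \<open>v\<close> of degree at most one in \<open>T\<close> has no incoming or no outgoing arrow in \<open>T\<close>. Say no incoming
  one: as arrows outside \<open>T\<close> close up along \<open>T\<close>, an arrow outside \<open>T\<close> leaving \<open>v\<close> is a repeated loop. So the
  arrow of \<open>T\<close> at \<open>v\<close> is the only arrow leaving \<open>v\<close>, and it can be contracted.
\<close>

lemma path_equiv_zero_if_repeated_off_tree:
  assumes "walk (set h) src tgt u h u" and "h \<noteq> []" and "T \<subseteq> set h"
    and "card T < card (src ` set h)"
    and "\<And>f. f \<in> set h - T \<Longrightarrow> (tgt f, src f) \<in> (arrow_rel src tgt T)\<^sup>* \<and> count (mset h) f \<ge> 2"
  shows "path_equiv (set h) src tgt (Some h) None"
  using assms
proof (induction "card T" arbitrary: T src tgt h u rule: less_induct)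
  case less
  note w = less.prems(1) and T = less.prems(3) and F = less.prems(5)
  let ?V = "src ` set h"
  have Veq: "?V = tgt ` set h"
    using w by (rule walk_closed_src_eq_tgt)
  have fin: "finite T"
    using T finite_subset by blast
  show ?case
  proof (rule ccontr)
    assume nz: "\<not> ?case"
    \<comment> \<open>This also replaces a base case: for empty \<open>T\<close> every arrow of
      \<open>h\<close> would be a loop occurring at least twice.\<close>
    have no_loop: "src f \<noteq> tgt f" if "f \<in> set h - T" for f
      using path_equiv_zero_if_repeated_loop[OF w] F[OF that] nz by blast
    obtain v where v: "v \<in> ?V" and deg: "card {t \<in> T. src t = v} + card {t \<in> T. tgt t = v} \<le> 1"
    proof -
      have "tgt ` T \<subseteq> ?V"
        unfolding Veq using T by (rule image_mono)
      from exists_vertex_degree_le_one[OF _ fin less.prems(4) image_mono[OF T] this] show thesis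
        using that by blast
    qed
    \<comment> \<open>The step common to both cases: \<open>r\<close> is the other end of
      \<open>t\<close>, \<open>\<pi>\<close> merges \<open>v\<close> into \<open>r\<close>, and
      \<open>\<phi>\<close> reinserts \<open>t\<close>. The condition \<open>other\<close> keeps the
      contracted path nonempty and \<open>r\<close> among its vertices.\<close>
    have contract: False
      if t: "t \<in> T" and \<pi>: "\<pi> = (\<lambda>x. if x = v then r else x)" "\<pi> (src t) = r" "\<pi> (tgt t) = r"
        and r: "r \<noteq> v" "r \<in> ?V"
        and other: "\<exists>a\<in>set h - {t}. \<pi> (src a) = r"
        and \<phi>: "\<And>a. \<phi> a \<noteq> []"
          "\<And>a. a \<in> set h - {t} \<Longrightarrow> walk (set h) src tgt (\<pi> (src a)) (\<phi> a) (\<pi> (tgt a))"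
          "\<And>g y. walk (set h) src tgt y g y \<Longrightarrow> y \<noteq> v \<Longrightarrow> concat (map \<phi> (filter (\<lambda>a. a \<noteq> t) g)) = g"
      for t r \<pi> \<phi>
    proof -
      obtain a where a: "a \<in> set h" "src a = r"
        using r(2) by auto
      \<comment> \<open>Rotating \<open>h\<close> to be closed at \<open>r\<close> ensures that it
        does not end at \<open>v\<close>, as reinsertion of \<open>t\<close> requires.\<close>
      obtain g where g: "walk (set h) src tgt r g r" "path_equiv (set h) src tgt (Some h) (Some g)"
        "mset g = mset h"
        using rotate_to_arrow[OF w a(1)] a(2) by metis
      have setg: "set g = set h"
        using g(3) by (rule mset_eq_setD)
      let ?g = "filter (\<lambda>a. a \<noteq> t) g"
      have setg': "set ?g = set h - {t}"
        using setg by auto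
      have tt: "\<pi> (src t) = \<pi> (tgt t)"
        using \<pi> by simp
      have "path_equiv (set ?g) (\<pi> \<circ> src) (\<pi> \<circ> tgt) (Some ?g) None"
      proof (rule less.hyps[where T = "T - {t}"])
        show "card (T - {t}) < card T"
          using t fin by (rule card_Diff1_less[rotated])
        show "walk (set ?g) (\<pi> \<circ> src) (\<pi> \<circ> tgt) (\<pi> r) ?g (\<pi> r)"
          unfolding setg' by (rule walk_contract[OF g(1) tt])
        show "?g \<noteq> []"
          using other setg' by (metis empty_iff list.set(1))
        show "T - {t} \<subseteq> set ?g"
          using T setg' by auto
        \<comment> \<open>At most the vertex \<open>v\<close> is lost, while \<open>T\<close> loses
          exactly one arrow, so the strict inequality survives.\<close>
        have "?V - {v} \<subseteq> (\<pi> \<circ> src) ` set ?g"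
        proof
          fix x assume x: "x \<in> ?V - {v}"
          then obtain b where b: "b \<in> set h" "x = src b"
            by auto
          show "x \<in> (\<pi> \<circ> src) ` set ?g"
          proof (cases "b = t")
            case True
            then have "x = r"
              using x b \<pi> by auto
            then show ?thesis
              using other unfolding setg' by auto
          next
            case False
            then show ?thesis
              using x b \<pi>(1) unfolding setg' by (intro image_eqI[of _ _ b]) auto
          qed
        qed
        then have "card (?V - {v}) \<le> card ((\<pi> \<circ> src) ` set ?g)"
          by (intro card_mono) auto
        then show "card (T - {t}) < card ((\<pi> \<circ> src) ` set ?g)"
        proof -
          have "card T > 0"
            using t fin card_gt_0_iff by blast
          then show ?thesis
            using \<open>card (?V - {v}) \<le> _\<close> less.prems(4) v t fin by simp
        qed
        fix f assume "f \<in> set ?g - (T - {t})"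
        then have f: "f \<in> set h - T" "f \<noteq> t"
          unfolding setg' by auto
        have "count (mset ?g) f = count (mset h) f"
          using f(2) g(3) by simp
        then show "((\<pi> \<circ> tgt) f, (\<pi> \<circ> src) f) \<in> (arrow_rel (\<pi> \<circ> src) (\<pi> \<circ> tgt) (T - {t}))\<^sup>*
            \<and> count (mset ?g) f \<ge> 2"
          using F[OF f(1)] arrow_rel_contract[of "tgt f" "src f" src tgt T \<pi> t] tt by simp
      qed
      \<comment> \<open>Substituting \<open>\<phi>\<close> undoes the contraction and pulls the
        equivalence with 0 back to \<open>g\<close>.\<close>
      then have "path_equiv (set h) src tgt (map_option (\<lambda>p. concat (map \<phi> p)) (Some ?g))
        (map_option (\<lambda>p. concat (map \<phi> p)) None)"
        using \<phi>(1,2) unfolding setg' by (intro path_equiv_substitute[where A' = "set h - {t}"]) auto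
      then have "path_equiv (set h) src tgt (Some g) None"
        using \<phi>(3)[OF g(1) r(1)] by simp
      then show False
        using g(2) nz path_equiv.trans by blast
    qed
    from deg consider "{t \<in> T. tgt t = v} = {}" | "{t \<in> T. src t = v} = {}"
    proof -
      have "card {t \<in> T. tgt t = v} = 0 \<or> card {t \<in> T. src t = v} = 0"
        using deg by linarith
      then show thesis
        using that fin by auto
    qed
    then show False
    proof cases
      case 1
      have inT: "f \<in> T" if "f \<in> set h" "src f = v" for f
      proof (rule ccontr)
        assume "f \<notin> T"
        then have "(tgt f, v) \<in> (arrow_rel src tgt T)\<^sup>*" "src f \<noteq> tgt f"
          using F no_loop that by blast+
        then have "\<exists>y. (y, v) \<in> arrow_rel src tgt T"
          using that by (metis rtranclE)
        then show False
          using 1 by (auto simp: arrow_rel_def)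
      qed
      obtain t where t: "t \<in> set h" "src t = v"
        using v by auto
      have tT: "t \<in> T" and "tgt t \<noteq> v"
        using inT[OF t] 1 by auto
      have uniq: "a = t" if "a \<in> set h" "src a = v" for a
      proof -
        have "card {t \<in> T. src t = v} \<le> 1"
          using deg by simp
        then show ?thesis
          using inT that t fin by (auto simp: card_le_Suc0_iff_eq)
      qed
      have "tgt t \<in> ?V"
        using t Veq by auto
      moreover from this obtain a where "tgt t = src a" "a \<in> set h"
        by (rule imageE)
      then have "\<exists>a\<in>set h - {t}. (if src a = v then tgt t else src a) = tgt t"
        using t \<open>tgt t \<noteq> v\<close> by (intro bexI[of _ a]) auto
      ultimately show False
      proof (intro contract[OF tT refl, where r = "tgt t" and \<phi> = "\<lambda>f. if tgt f = v then [f, t] else [f]"])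
        show "concat (map (\<lambda>f. if tgt f = v then [f, t] else [f]) (filter (\<lambda>a. a \<noteq> t) g)) = g"
          if "walk (set h) src tgt y g y" "y \<noteq> v" for y g
          using expand_out_arrow[OF that(1) \<open>tgt t \<noteq> v\<close> t(2) uniq that(2)] that(2) by simp
        fix a assume a: "a \<in> set h - {t}"
        then have "src a \<noteq> v"
          using uniq by blast
        then show "walk (set h) src tgt (if src a = v then tgt t else src a)
            (if tgt a = v then [a, t] else [a]) (if tgt a = v then tgt t else tgt a)"
          using a t by simp
      qed (use t \<open>tgt t \<noteq> v\<close> in simp_all)
    next
      \<comment> \<open>The mirror image: \<open>t\<close> is now the only arrow entering
        \<open>v\<close> and is reinserted before the arrows leaving \<open>v\<close>.\<close>
      case 2
      have inT: "f \<in> T" if "f \<in> set h" "tgt f = v" for f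
      proof (rule ccontr)
        assume "f \<notin> T"
        then have "(v, src f) \<in> (arrow_rel src tgt T)\<^sup>*" "src f \<noteq> tgt f"
          using F no_loop that by blast+
        then have "\<exists>y. (v, y) \<in> arrow_rel src tgt T"
          using that by (metis converse_rtranclE)
        then show False
          using 2 by (auto simp: arrow_rel_def)
      qed
      obtain t where t: "t \<in> set h" "tgt t = v"
        using v Veq by auto
      have tT: "t \<in> T" and "src t \<noteq> v"
        using inT[OF t] 2 by auto
      have uniq: "a = t" if "a \<in> set h" "tgt a = v" for a
      proof -
        have "card {t \<in> T. tgt t = v} \<le> 1"
          using deg by simp
        then show ?thesis
          using inT that t fin by (auto simp: card_le_Suc0_iff_eq)
      qed
      have "src t \<in> ?V"
        using t by auto
      moreover from v obtain a where "v = src a" "a \<in> set h"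
        by (rule imageE)
      then have "\<exists>a\<in>set h - {t}. (if src a = v then src t else src a) = src t"
        using t \<open>src t \<noteq> v\<close> by (intro bexI[of _ a]) auto
      ultimately show False
      proof (intro contract[OF tT refl, where r = "src t" and \<phi> = "\<lambda>f. if src f = v then [t, f] else [f]"])
        show "concat (map (\<lambda>f. if src f = v then [t, f] else [f]) (filter (\<lambda>a. a \<noteq> t) g)) = g"
          if "walk (set h) src tgt y g y" "y \<noteq> v" for y g
          using expand_in_arrow[OF that(1) \<open>src t \<noteq> v\<close> t(2) uniq that(2)] that(2) by simp
        fix a assume a: "a \<in> set h - {t}"
        then have "tgt a \<noteq> v"
          using uniq by blast
        then show "walk (set h) src tgt (if src a = v then src t else src a)
            (if src a = v then [t, a] else [a]) (if tgt a = v then src t else tgt a)"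
          using a t by simp
      qed (use t \<open>src t \<noteq> v\<close> in simp_all)
    qed
  qed
qed

subsection \<open>Feedback arrows\<close>

lemma walk_imp_trancl:
  assumes "walk T src tgt u p v" and "p \<noteq> []"
  shows "(u, v) \<in> (arrow_rel src tgt T)\<^sup>+"
  using assms
proof (induction p arbitrary: u)
  case (Cons a p)
  then have a: "(u, tgt a) \<in> arrow_rel src tgt T" and w: "walk T src tgt (tgt a) p v"
    by (auto simp: arrow_rel_def)
  show ?case
  proof (cases "p = []")
    case True
    then show ?thesis
      using a w by auto
  next
    case False
    then show ?thesis
      using a Cons.IH[OF w] by auto
  qed
qed simp

lemma trancl_imp_walk:
  assumes "(u, v) \<in> (arrow_rel src tgt T)\<^sup>+"
  shows "\<exists>p. p \<noteq> [] \<and> walk T src tgt u p v"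
  using assms
proof (induction rule: trancl_induct)
  case (base y)
  then obtain a where "a \<in> T" "src a = u" "tgt a = y"
    by (auto simp: arrow_rel_def)
  then show ?case
    by (intro exI[of _ "[a]"]) simp
next
  case (step y z)
  then obtain p a where "walk T src tgt u p y" "a \<in> T" "src a = y" "tgt a = z"
    by (auto simp: arrow_rel_def)
  then show ?case
    by (intro exI[of _ "p @ [a]"]) simp
qed

text \<open>Between two arrivals at the same vertex lies a closed walk; cutting it out leaves a
  closed walk.\<close>

lemma split_closed_walk:
  assumes "walk A src tgt u h u" and "\<not> distinct (map tgt h)"
  obtains p q v where "walk A src tgt v p v" "walk A src tgt u q u" "p \<noteq> []" "q \<noteq> []"
    "mset h = mset p + mset q"
proof -
  obtain xs y ys zs where d: "map tgt h = xs @ [y] @ ys @ [y] @ zs"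
    using not_distinct_decomp[OF assms(2)] by blast
  then obtain a f b g c where h: "h = a @ f # b @ g # c" "tgt f = y" "tgt g = y"
    by (auto simp: map_eq_append_conv map_eq_Cons_conv append_eq_map_conv Cons_eq_map_conv)
  show thesis
  proof (rule that)
    show "walk A src tgt y (b @ [g]) y" "walk A src tgt u (a @ f # c) u"
      using assms(1) h by auto
  qed (simp_all add: h)
qed

lemma closed_walk_contains_cycle:
  assumes "walk A src tgt u h u" and "h \<noteq> []"
  shows "\<exists>c v. c \<noteq> [] \<and> distinct (map tgt c) \<and> walk A src tgt v c v"
  using assms
proof (induction "length h" arbitrary: h u rule: less_induct)
  case less
  show ?case
  proof (cases "distinct (map tgt h)")
    case True
    then show ?thesis
      using less.prems by blast
  next
    case False
    obtain p q v where pq: "walk A src tgt v p v" "walk A src tgt u q u" "p \<noteq> []" "q \<noteq> []"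
      "mset h = mset p + mset q"
      using split_closed_walk[OF less.prems(1) False] .
    have "length p < length h"
      using pq(4) arg_cong[OF pq(5), of size] by simp
    then show ?thesis
      using less.hyps pq(1,3) by blast
  qed
qed

lemma acyclic_arrow_relI:
  assumes "\<And>c v. c \<noteq> [] \<Longrightarrow> distinct (map tgt c) \<Longrightarrow> \<not> walk T src tgt v c v"
  shows "acyclic (arrow_rel src tgt T)"
  unfolding acyclic_def
proof (intro allI notI)
  fix x assume "(x, x) \<in> (arrow_rel src tgt T)\<^sup>+"
  then obtain p where "p \<noteq> []" "walk T src tgt x p x"
    using trancl_imp_walk[of x x src tgt T] by blast
  then show False
    using closed_walk_contains_cycle[of T src tgt x p] assms by blast
qed

text \<open>Both sides are additive when a closed walk is cut out. A closed walk with distinct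
  targets has length at most \<open>m\<close> and, \<open>T\<close> being acyclic, an arrow outside
  \<open>T\<close>.\<close>

lemma length_le_feedback_count:
  assumes "acyclic (arrow_rel src tgt T)"
    and m: "\<And>c v. c \<noteq> [] \<Longrightarrow> distinct (map tgt c) \<Longrightarrow> walk A src tgt v c v \<Longrightarrow> length c \<le> m"
    and "walk A src tgt u h u"
  shows "length h \<le> m * size {#a \<in># mset h. a \<notin> T#}"
  using assms(3)
proof (induction "length h" arbitrary: h u rule: less_induct)
  case less
  show ?case
  proof (cases "h = [] \<or> \<not> distinct (map tgt h)")
    case True
    show ?thesis
    proof (cases "h = []")
      case False
      with True have "\<not> distinct (map tgt h)" by simp
      then obtain p q v where pq: "walk A src tgt v p v" "walk A src tgt u q u" "p \<noteq> []" "q \<noteq> []"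
        "mset h = mset p + mset q"
        using split_closed_walk[OF less.prems] by blast
      have len: "length h = length p + length q"
        using arg_cong[OF pq(5), of size] by simp
      then have "length p < length h" "length q < length h"
        using pq(3,4) by auto
      then have "length p + length q \<le>
          m * size {#a \<in># mset p. a \<notin> T#} + m * size {#a \<in># mset q. a \<notin> T#}"
        using less.hyps[OF _ pq(1)] less.hyps[OF _ pq(2)] by linarith
      then show ?thesis
        unfolding len pq(5) by (simp add: distrib_left)
    qed simp
  next
    case False
    then have "length h \<le> m"
      using m less.prems by blast
    moreover have "\<not> set h \<subseteq> T"
      using walk_imp_trancl[OF walk_mono[OF less.prems]] False assms(1) unfolding acyclic_def by blast
    then obtain a where "a \<in># {#a \<in># mset h. a \<notin> T#}"
      by auto
    then have "size {#a \<in># mset h. a \<notin> T#} > 0"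
      by (metis empty_iff nonempty_has_size set_mset_empty)
    then have "size {#a \<in># mset h. a \<notin> T#} \<ge> 1"
      by simp
    then have "m * 1 \<le> m * size {#a \<in># mset h. a \<notin> T#}"
      by (rule mult_le_mono2)
    ultimately show ?thesis
      by linarith
  qed
qed

section \<open>Size of a maximal acyclic set of arrows\<close>

text \<open>A vertex set grown from one vertex across arrows of \<open>T\<close>, regardless of
  direction, gains at least one inner arrow with each new vertex.\<close>

lemma card_le_Suc_if_connected:
  assumes fin: "finite V" "finite T" and "V \<noteq> {}"
    and cross: "\<And>S. S \<subseteq> V \<Longrightarrow> S \<noteq> {} \<Longrightarrow> S \<noteq> V \<Longrightarrow>
      \<exists>t\<in>T. src t \<in> S \<and> tgt t \<in> V - S \<or> tgt t \<in> S \<and> src t \<in> V - S"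
  shows "card V \<le> Suc (card T)"
proof -
  have "\<exists>S\<subseteq>V. card S = Suc k \<and> k \<le> card {t \<in> T. src t \<in> S \<and> tgt t \<in> S}" if "k < card V" for k
    using that
  proof (induction k)
    case 0
    then show ?case
      using assms(3) by (metis card_1_singleton_iff empty_subsetI ex_in_conv insert_subset le0 One_nat_def)
  next
    case (Suc k)
    then obtain S where S: "S \<subseteq> V" "card S = Suc k" "k \<le> card {t \<in> T. src t \<in> S \<and> tgt t \<in> S}"
      by auto
    have "S \<noteq> {}" "S \<noteq> V"
      using S(2) Suc.prems by auto
    then obtain t v where t: "t \<in> T" "v \<in> V - S" "{src t, tgt t} \<subseteq> insert v S" "\<not> {src t, tgt t} \<subseteq> S"
      using cross[OF S(1)] by blast
    let ?E = "\<lambda>S. {t \<in> T. src t \<in> S \<and> tgt t \<in> S}"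
    have "insert t (?E S) \<subseteq> ?E (insert v S)" "t \<notin> ?E S"
      using t by auto
    then have "Suc (card (?E S)) \<le> card (?E (insert v S))"
      using fin(2) card_mono[of "?E (insert v S)" "insert t (?E S)"] by simp
    moreover have "card (insert v S) = Suc (Suc k)"
      using S t(2) fin(1) finite_subset by (metis DiffD2 card_insert_disjoint)
    ultimately show ?case
      using S t(2) by (intro exI[of _ "insert v S"]) auto
  qed
  moreover have "card V > 0"
    using assms by (simp add: card_gt_0_iff)
  ultimately obtain S where "card V - 1 \<le> card {t \<in> T. src t \<in> S \<and> tgt t \<in> S}"
    by (meson diff_less zero_less_one)
  also have "\<dots> \<le> card T"
    using fin(2) by (intro card_mono) auto
  finally show ?thesis
    by simp
qed

text \<open>Otherwise the walk, rotated to start in \<open>S\<close>, would stay in \<open>S\<close>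
  and hence visit no other vertex.\<close>

lemma closed_walk_leaves:
  assumes w: "walk A src tgt u h u" and "S \<noteq> {}" "S \<subseteq> src ` set h" "S \<noteq> src ` set h"
  shows "\<exists>a\<in>set h. src a \<in> S \<and> tgt a \<notin> S"
proof (rule ccontr)
  assume no: "\<not> ?thesis"
  have stay: "v \<in> S \<and> tgt ` set p \<subseteq> S" if "walk A src tgt x p v" "x \<in> S" "set p \<subseteq> set h" for x p v
    using that no by (induction p arbitrary: x) auto
  obtain a where a: "a \<in> set h" "src a \<in> S"
    using assms(2,3) by blast
  obtain g where g: "walk A src tgt (src a) g (src a)" "mset g = mset h"
    using rotate_to_arrow[OF w a(1)] by metis
  have "set g = set h"
    using g(2) by (rule mset_eq_setD)
  then have "tgt ` set h \<subseteq> S"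
    using stay[OF g(1) a(2)] by auto
  then show False
    using walk_closed_src_eq_tgt[OF w] assms(3,4) by auto
qed

text \<open>By maximality, adding \<open>f\<close> creates a cycle, which must return along
  \<open>T\<close> from \<open>tgt f\<close> to \<open>src f\<close>; for a loop this return is
  trivial.\<close>

lemma exists_maximal_acyclic:
  assumes "finite A" and "H \<subseteq> A" and "acyclic (arrow_rel src tgt H)"
  obtains T where "H \<subseteq> T" "T \<subseteq> A" "acyclic (arrow_rel src tgt T)"
    "\<And>f. f \<in> A - T \<Longrightarrow> (tgt f, src f) \<in> (arrow_rel src tgt T)\<^sup>*"
proof -
  let ?P = "\<lambda>T. H \<subseteq> T \<and> T \<subseteq> A \<and> acyclic (arrow_rel src tgt T)"
  have "finite {T. ?P T}"
    by (rule finite_subset[of _ "Pow A"]) (use assms(1) in auto)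
  then obtain T where T: "?P T" and max: "\<And>T'. ?P T' \<Longrightarrow> T \<subseteq> T' \<Longrightarrow> T' = T"
  proof -
    have "H \<in> {T. ?P T}"
      using assms(2,3) by simp
    from finite_has_maximal2[OF \<open>finite {T. ?P T}\<close> this] show thesis
      using that by (metis (no_types, lifting) mem_Collect_eq)
  qed
  have "(tgt f, src f) \<in> (arrow_rel src tgt T)\<^sup>*" if f: "f \<in> A - T" for f
  proof (rule ccontr)
    assume "\<not> ?thesis"
    moreover have "arrow_rel src tgt (insert f T) = insert (src f, tgt f) (arrow_rel src tgt T)"
      by (simp add: arrow_rel_def)
    ultimately have "?P (insert f T)"
      using T f by (auto simp: acyclic_insert)
    then have "insert f T = T"
      using max by blast
    then show False
      using f by blast
  qed
  then show thesis
    using that T by blast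
qed

text \<open>Some arrow of \<open>h\<close> leaves \<open>S\<close>. If it is not in
  \<open>T\<close>, the path in \<open>T\<close> from its target back to its source must enter
  \<open>S\<close>, so an arrow of \<open>T\<close> crosses in either case.\<close>

lemma card_maximal_acyclic:
  assumes w: "walk A src tgt u h u" and "h \<noteq> []" and "T \<subseteq> set h"
    and max: "\<And>f. f \<in> set h - T \<Longrightarrow> (tgt f, src f) \<in> (arrow_rel src tgt T)\<^sup>*"
  shows "card (src ` set h) \<le> Suc (card T)"
proof (rule card_le_Suc_if_connected[where src = src and tgt = tgt])
  show "finite T"
    using assms(3) finite_subset by blast
  fix S assume S: "S \<subseteq> src ` set h" "S \<noteq> {}" "S \<noteq> src ` set h"
  have Veq: "src ` set h = tgt ` set h"
    using w by (rule walk_closed_src_eq_tgt)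
  show "\<exists>t\<in>T. src t \<in> S \<and> tgt t \<in> src ` set h - S \<or> tgt t \<in> S \<and> src t \<in> src ` set h - S"
  proof (rule ccontr)
    assume no: "\<not> ?thesis"
    obtain a where a: "a \<in> set h" "src a \<in> S" "tgt a \<notin> S"
      using closed_walk_leaves[OF w S(2,1,3)] by blast
    have "tgt a \<in> src ` set h"
      using a Veq by simp
    then have "a \<notin> T"
      using no a by blast
    have "y \<notin> S" if "(tgt a, y) \<in> (arrow_rel src tgt T)\<^sup>*" for y
      using that
    proof (induction rule: rtrancl_induct)
      case base
      show ?case by (rule a(3))
    next
      case (step y z)
      then obtain t where t: "t \<in> T" "y = src t" "z = tgt t"
        by (auto simp: arrow_rel_def)
      then show ?case
        using no step.IH assms(3) by blast
    qed
    then show False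
      using max[of a] a \<open>a \<notin> T\<close> by blast
  qed
qed (use assms(2) in auto)

lemma size_filter_mset_le:
  assumes "finite F" and "\<And>f. f \<in># M \<Longrightarrow> P f \<Longrightarrow> f \<in> F" and "\<And>f. f \<in> F \<Longrightarrow> count M f \<le> b f"
  shows "size (filter_mset P M) \<le> (\<Sum>f\<in>F. b f)"
proof -
  have "size (filter_mset P M) = (\<Sum>f\<in>set_mset (filter_mset P M). count (filter_mset P M) f)"
    by (rule size_multiset_overloaded_eq)
  also have "\<dots> \<le> (\<Sum>f\<in>set_mset (filter_mset P M). b f)"
    using assms(2,3) by (intro sum_mono) auto
  also have "\<dots> \<le> (\<Sum>f\<in>F. b f)"
    using assms(1,2) by (intro sum_mono2) auto
  finally show ?thesis .
qed

text \<open>The bound for the subquiver of arrows of \<open>h\<close>, stated additively to avoid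
  truncated subtraction.\<close>

lemma length_le_if_nonzero:
  assumes w: "walk A src tgt u h u" and "h \<noteq> []"
    and nz: "\<not> path_equiv A src tgt (Some h) None"
    and m: "\<And>c v. c \<noteq> [] \<Longrightarrow> distinct (map tgt c) \<Longrightarrow> walk A src tgt v c v \<Longrightarrow> length c \<le> m"
  shows "length h + 2 * m * card (src ` set h) \<le> 2 * m * card (set h) + m"
proof -
  let ?H = "{a \<in> set h. count (mset h) a \<ge> 3}"
  have "acyclic (arrow_rel src tgt ?H)"
  proof (rule acyclic_arrow_relI)
    fix c v assume c: "c \<noteq> []" "distinct (map tgt c)"
    show "\<not> walk ?H src tgt v c v"
    proof
      assume w': "walk ?H src tgt v c v"
      then have sub: "set c \<subseteq> ?H"
        by (rule walk_set)
      then have "walk A src tgt v c v"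
        using walk_mono[OF w'] walk_set[OF w] by blast
      then have "path_equiv A src tgt (Some h) None"
        using path_equiv_zero_if_frequent_cycle[OF w, of v c] c sub by (auto simp: distinct_map)
      then show False
        using nz by blast
    qed
  qed
  then obtain T where T: "?H \<subseteq> T" "T \<subseteq> set h" "acyclic (arrow_rel src tgt T)"
    and max: "\<And>f. f \<in> set h - T \<Longrightarrow> (tgt f, src f) \<in> (arrow_rel src tgt T)\<^sup>*"
    using exists_maximal_acyclic[of "set h" ?H src tgt] by auto
  let ?F = "set h - T"
  let ?N = "size {#a \<in># mset h. a \<notin> T#}"
  have low: "count (mset h) f \<le> 2" if "f \<in> ?F" for f
    using that T(1) by force
  have cardF: "card (set h) = card ?F + card T"
    using T(2) by (metis List.finite_set card_Diff_subset card_mono finite_subset le_add_diff_inverse2)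
  \<comment> \<open>If \<open>card T\<close> is at least the number of vertices, multiplicity at
    most two suffices. Otherwise \<open>card T\<close> is one less, and one arrow of multiplicity at
    most one makes up for it.\<close>
  have "?N + 2 * card (src ` set h) \<le> 2 * card (set h) + 1"
  proof (cases "card T < card (src ` set h)")
    case False
    have "?N \<le> (\<Sum>f\<in>?F. 2)"
      using low by (intro size_filter_mset_le) auto
    then show ?thesis
      using False cardF by simp
  next
    case True
    \<comment> \<open>\<open>T\<close> is a tree: without such an \<open>f\<close> the bound would be off by one.\<close>
    have "\<exists>f\<in>?F. count (mset h) f \<le> 1"
    proof (rule ccontr)
      assume no: "\<not> ?thesis"
      \<comment> \<open>Contraction works in the quiver of arrows of \<open>h\<close>, where the
        uniqueness of \<open>t\<close> at \<open>v\<close> can be checked; the result then transfers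
        to \<open>A\<close>.\<close>
      have "path_equiv (set h) src tgt (Some h) None"
      proof (rule path_equiv_zero_if_repeated_off_tree[OF _ assms(2) T(2) True])
        show "walk (set h) src tgt u h u"
          using w by (rule walk_mono) simp
        fix f assume f: "f \<in> ?F"
        then have "\<not> count (mset h) f \<le> 1"
          using no by blast
        then show "(tgt f, src f) \<in> (arrow_rel src tgt T)\<^sup>* \<and> count (mset h) f \<ge> 2"
          using max[OF f] by simp
      qed
      then show False
        using nz path_equiv_mono walk_set[OF w] by blast
    qed
    then obtain f where f: "f \<in> ?F" "count (mset h) f \<le> 1"
      by blast
    have "?N \<le> (\<Sum>g\<in>?F. if g = f then 1 else 2)"
      using low f by (intro size_filter_mset_le) auto
    also have "\<dots> = 1 + (\<Sum>g\<in>?F - {f}. 2)"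
      using f(1) by (subst sum.remove[of _ f]) (auto intro!: sum.cong)
    also have "\<dots> + 1 = 2 * card ?F"
      using f(1) card_Suc_Diff1[of ?F f] by simp
    finally have "?N + 1 \<le> 2 * card ?F"
      by simp
    then show ?thesis
      using card_maximal_acyclic[OF w assms(2) T(2) max] cardF by simp
  qed
  then have "m * (?N + 2 * card (src ` set h)) \<le> m * (2 * card (set h) + 1)"
    by (rule mult_le_mono2)
  moreover have "length h \<le> m * ?N"
    using length_le_feedback_count[OF T(3) m w] .
  ultimately show ?thesis
    by (simp add: algebra_simps)
qed

section \<open>Primitive closed paths and passage to the whole quiver\<close>

lemma primitive_if_distinct_targets:
  assumes w: "walk A src tgt v c v" and "c \<noteq> []" "distinct (map tgt c)"
  shows "primitive A src tgt c"
  unfolding primitive_def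
proof (intro conjI ballI)
  show "closed_path A src tgt c"
    using w assms(2) by (rule closed_pathI)
  fix x assume "x \<in> path_vertices src tgt c"
  moreover have "src (hd c) \<in> tgt ` set c"
    using walk_hd[OF w] walk_last[OF w] assms(2) by (metis image_eqI last_in_set)
  ultimately have "x \<in> tgt ` set c"
    by (auto simp: path_vertices_def)
  then obtain i where i: "i < length c" "tgt (c ! i) = x"
    by (metis image_iff in_set_conv_nth)
  have "j = i" if "j < length c" "tgt (c ! j) = x" for j
    using assms(3) i that by (metis length_map nth_eq_iff_index_eq nth_map)
  then have "{i. i < length c \<and> tgt (c ! i) = x} = {i}"
    using i by blast
  then show "card {i. i < length c \<and> tgt (c ! i) = x} = 1"
    by simp
qed

lemma primitive_imp_distinct:
  assumes "primitive A src tgt c"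
  shows "distinct c" "set c \<subseteq> A"
proof -
  show "set c \<subseteq> A"
    using assms by (auto simp: primitive_def closed_path_def is_path_def)
  show "distinct c"
    unfolding distinct_conv_nth
  proof (intro allI impI)
    fix i j assume ij: "i < length c" "j < length c" "i \<noteq> j"
    let ?I = "{k. k < length c \<and> tgt (c ! k) = tgt (c ! i)}"
    have "tgt (c ! i) \<in> path_vertices src tgt c"
      using ij(1) by (auto simp: path_vertices_def)
    then have "card ?I = 1"
      using assms by (auto simp: primitive_def)
    then obtain k where "?I = {k}"
      by (rule card_1_singletonE)
    then show "c ! i \<noteq> c ! j"
      using ij by (metis (mono_tags, lifting) mem_Collect_eq singletonD)
  qed
qed

text \<open>A primitive path has distinct arrows from the finite set \<open>A\<close>, so
  \<open>mQ\<close> is the maximum of a finite set.\<close>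

lemma length_primitive_le_mQ:
  assumes "finite A" and "primitive A src tgt c"
  shows "length c \<le> mQ A src tgt"
proof -
  have "{p. primitive A src tgt p} \<subseteq> {p. set p \<subseteq> A \<and> distinct p}"
    using primitive_imp_distinct by blast
  then have "finite {p. primitive A src tgt p}"
    using finite_subset_distinct[OF assms(1)] finite_subset by blast
  then show ?thesis
    using assms(2) unfolding mQ_def by (intro Max_ge) auto
qed

theorem theorem6p2:
  fixes Vs :: "'v set" and As :: "'a set" and src tgt :: "'a \<Rightarrow> 'v"
    and n d m :: nat and h :: "'a list"
  assumes "infinite (UNIV :: 'k::field set)" and "CHAR('k) = 2"
    and "in_Qndm Vs As src tgt n d m"
    and "closed_path As src tgt h"
    and "\<not> path_equiv As src tgt (Some h) None"
  shows "int (length h) \<le> 2 * int m * (int d - int n) + int m"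
proof -
  have Q: "finite Vs" "finite As" "\<And>a. a \<in> As \<Longrightarrow> src a \<in> Vs"
    "strongly_connected Vs As src tgt" "card Vs = n" "card As = d" "mQ As src tgt = m"
    using assms(3) unfolding in_Qndm_def quiver_def by blast+
  obtain u where h: "h \<noteq> []" "walk As src tgt u h u"
    using assms(4) by (auto simp: closed_path_iff_walk)
  have sub: "set h \<subseteq> As"
    using h(2) by (rule walk_set)
  let ?V = "src ` set h"
  have len: "length h + 2 * m * card ?V \<le> 2 * m * card (set h) + m"
  proof (rule length_le_if_nonzero[OF h(2,1) assms(5)])
    show "length c \<le> m" if "c \<noteq> []" "distinct (map tgt c)" "walk As src tgt v c v" for c v
      using length_primitive_le_mQ[OF Q(2) primitive_if_distinct_targets[OF that(3,1,2)]] Q(7) by simp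
  qed
  obtain p where p: "closed_path As src tgt p" "Vs \<subseteq> path_vertices src tgt p"
    using Q(4) by (auto simp: strongly_connected_def)
  then obtain v where v: "p \<noteq> []" "walk As src tgt v p v"
    by (auto simp: closed_path_iff_walk)
  have "path_vertices src tgt p = src ` set p"
    using walk_closed_src_eq_tgt[OF v(2)] v(1) by (auto simp: path_vertices_def)
  \<comment> \<open>By strong connectedness each vertex is the source of some arrow; for a vertex
    missed by \<open>h\<close> that arrow is missed too. So arrows minus vertices is no larger for
    \<open>h\<close> than for the whole quiver.\<close>
  then have "Vs - ?V \<subseteq> src ` (As - set h)"
    using p(2) walk_set[OF v(2)] by fast
  then have "card (Vs - ?V) \<le> card (As - set h)"
    using Q(2) by (meson card_image_le card_mono finite_Diff finite_imageI le_trans)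
  moreover have "card (Vs - ?V) + card ?V = n"
  proof -
    have "?V \<subseteq> Vs"
      using Q(3) sub by blast
    then show ?thesis
      using card_Diff_subset[of ?V Vs] card_mono[OF Q(1)] Q(5) by simp
  qed
  moreover have "card (As - set h) + card (set h) = d"
    using card_Diff_subset[OF _ sub] card_mono[OF Q(2) sub] Q(6) by simp
  ultimately have "int (card (set h)) - int (card ?V) \<le> int d - int n"
    by linarith
  then have "2 * int m * (int (card (set h)) - int (card ?V)) \<le> 2 * int m * (int d - int n)"
    by (intro mult_left_mono) auto
  moreover have "int (length h) + 2 * int m * int (card ?V) \<le> 2 * int m * int (card (set h)) + int m"
    using len by (metis (no_types, lifting) of_nat_add of_nat_le_iff of_nat_mult of_nat_numeral)
  ultimately show ?thesis
    by (simp add: right_diff_distrib)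
qed

end
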